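(* The divisibility lattice $\langle\mathbb N,\mid\rangle$ is not reversible.
   Context: $\mathbb N=\{1,2,\dots\}$ and $m\mid n$ iff $n=km$ for some $k\in\mathbb N$. A poset $\langle P,\leq\rangle$ is reversible iff each bijection $f:P\to P$ with $x\leq y\Rightarrow f(x)\leq f(y)$ for all $x,y\in P$ is an automorphism. *)

theory Defs
  imports Main
begin

definition order_automorphism_on :: "'a set \<Rightarrow> ('a \<Rightarrow> 'a \<Rightarrow> bool) \<Rightarrow> ('a \<Rightarrow> 'a) \<Rightarrow> bool" where
  "order_automorphism_on P le f \<longleftrightarrow>
     bij_betw f P P \<and> (\<forall>x\<in>P. \<forall>y\<in>P. le x y \<longleftrightarrow> le (f x) (f y))"

text \<open>The notion is meant for posets. That \<^term>\<open>le\<close> is a partial order on \<^term>\<open>P\<close> is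
  deliberately not part of the definition, so that its negation cannot hold merely because
  \<^term>\<open>le\<close> fails to be one.\<close>

definition reversible_on :: "'a set \<Rightarrow> ('a \<Rightarrow> 'a \<Rightarrow> bool) \<Rightarrow> bool" where
  "reversible_on P le \<longleftrightarrow>
     (\<forall>f. bij_betw f P P \<longrightarrow> monotone_on P le le f \<longrightarrow> order_automorphism_on P le f)"

abbreviation pos_nats :: "nat set" where
  "pos_nats \<equiv> {n. 1 \<le> n}"

text \<open>On positive naturals the library relation \<^term>\<open>(dvd)\<close> allows only positive cofactors.\<close>

lemma dvd_pos_nats_iff:
  assumes "m \<in> pos_nats" "n \<in> pos_nats"
  shows "m dvd n \<longleftrightarrow> (\<exists>k\<in>pos_nats. n = k * m)"
  using assms by (auto simp: dvd_def mult.commute Suc_le_eq)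

lemma partial_order_on_dvd_pos_nats:
  "partial_order_on pos_nats (relation_of (dvd) pos_nats)"
  by (rule partial_order_on_relation_ofI) (auto intro: dvd_trans dvd_antisym)

end

theory Submission
  imports Defs "HOL-Library.Infinite_Set" "HOL-Computational_Algebra.Primes"
begin

text \<open>
  Send every non-prime \<open>n\<close> to \<open>n!\<close>, and the primes bijectively and in increasing order onto the
  positive integers that are not of the form \<open>n!\<close> for a non-prime \<open>n\<close>.  All primes are among
  these, so the image of a prime \<open>p\<close> is at most \<open>p\<close> and therefore divides \<open>n!\<close> for each multiple
  \<open>n\<close> of \<open>p\<close>.  Hence the bijection preserves divisibility.  Its inverse does not: both \<open>2\<close> and \<open>4\<close>
  are images of primes.
\<close>

text \<open>Induction on \<open>n\<close>: the next element of \<open>A\<close> lies in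
  \<open>B\<close> and exceeds the \<open>n\<close>-th element of \<open>B\<close>, so it competes
  in the minimum that defines the next element of \<open>B\<close>.\<close>

lemma enumerate_subset_le:
  fixes A B :: "nat set"
  assumes "infinite A" "A \<subseteq> B"
  shows "enumerate B n \<le> enumerate A n"
proof -
  have B: "infinite B"
    using assms infinite_super by blast
  show ?thesis
  proof (induction n)
    case 0
    have "enumerate A 0 \<in> B"
      using enumerate_in_set[OF assms(1)] assms(2) by blast
    then show ?case
      unfolding enumerate_0[of B] by (rule Least_le)
  next
    case (Suc n)
    have "enumerate A (Suc n) \<in> B"
      using enumerate_in_set[OF assms(1)] assms(2) by blast
    moreover have "enumerate B n < enumerate A (Suc n)"
      using Suc.IH enumerate_step[OF assms(1), of n] by linarith
    ultimately show ?case
      unfolding enumerate_Suc''[OF B] by (auto intro: Least_le)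
  qed
qed

text \<open>Matching the elements of \<open>A\<close> and \<open>B\<close> by their rank in
  increasing order works, by the comparison of enumerations.\<close>

lemma ex_decreasing_bij_betw_superset:
  fixes A B :: "nat set"
  assumes "infinite A" "A \<subseteq> B"
  obtains h where "bij_betw h A B" "\<And>a. a \<in> A \<Longrightarrow> h a \<le> a"
proof
  let ?A = "enumerate A" and ?B = "enumerate B"
  have B: "infinite B"
    using assms infinite_super by blast
  have A: "bij_betw ?A UNIV A"
    by (rule bij_enumerate[OF assms(1)])
  show "bij_betw (?B \<circ> inv_into UNIV ?A) A B"
    using bij_betw_inv_into[OF A] bij_enumerate[OF B] by (rule bij_betw_trans)
  show "(?B \<circ> inv_into UNIV ?A) a \<le> a" if "a \<in> A" for a
    using enumerate_subset_le[OF assms] bij_betw_inv_into_right[OF A that] by (metis comp_apply)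
qed

lemma nonprime_cases:
  fixes n :: nat
  assumes "1 \<le> n" "\<not> prime n"
  obtains "n = 1" | "4 \<le> n"
proof -
  \<comment> \<open>\<open>num.Bit1 num.One\<close> encodes the numeral 3.\<close>
  have "n \<noteq> 2" "n \<noteq> 3"
    using assms(2) two_is_prime_nat prime_nat_numeral_eq[of "num.Bit1 num.One"] by auto
  then show ?thesis
    using assms(1) that by linarith
qed

theorem proposition5p6:
  shows "\<not> reversible_on pos_nats (dvd)"
proof
  assume rev: "reversible_on pos_nats (dvd)"
  define P where "P = {p::nat. prime p}"
  define N where "N = pos_nats - P"
  define R where "R = pos_nats - fact ` N"
  \<comment> \<open>The bound 24 is 4!. The gap between 1 and 24 later puts 2 and 4 into
    \<open>R\<close>; non-primality puts the primes there.\<close>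
  have fact_N: "fact n = (1::nat) \<or> 24 \<le> (fact n::nat) \<and> \<not> prime (fact n::nat)" if "n \<in> N" for n
  proof -
    have "1 \<le> n" "\<not> prime n"
      using that by (auto simp: N_def P_def)
    then show ?thesis
    proof (cases rule: nonprime_cases)
      case 2
      have "(fact 4::nat) dvd fact n"
        using 2 by (rule fact_dvd)
      moreover have "(fact 4::nat) = 24"
        by (simp add: fact_numeral)
      ultimately have d: "(24::nat) dvd fact n"
        by simp
      then have "24 \<le> (fact n::nat)"
        by (simp add: dvd_imp_le)
      \<comment> \<open>An even prime equals 2, which the bound 24 excludes.\<close>
      moreover have "(2::nat) dvd fact n"
        using d by (rule dvd_trans[rotated]) simp
      ultimately show ?thesis
        by (auto dest: primes_dvd_imp_eq[OF two_is_prime_nat])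
    qed simp
  qed
  have "infinite P"
    unfolding P_def by (rule primes_infinite)
  moreover have PR: "P \<subseteq> R"
  proof
    fix p assume "p \<in> P"
    then have "prime p"
      by (simp add: P_def)
    moreover from this have "p \<noteq> fact n" if "n \<in> N" for n
      using fact_N[OF that] by (metis not_prime_1)
    ultimately show "p \<in> R"
      by (auto simp: R_def dest: prime_ge_1_nat)
  qed
  ultimately obtain h where h: "bij_betw h P R" and h_le: "\<And>p. p \<in> P \<Longrightarrow> h p \<le> p"
    by (rule ex_decreasing_bij_betw_superset) blast
  have h_pos: "1 \<le> h p" if "p \<in> P" for p
    using bij_betwE[OF h] that by (auto simp: R_def)
  define f where "f = (\<lambda>n. if n \<in> P then h n else fact n)"
  \<comment> \<open>Since 0 is not in \<open>N\<close>, the coincidence 0! = 1! does no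
    harm.\<close>
  have "inj_on (fact :: nat \<Rightarrow> nat) N"
  proof (rule linorder_inj_onI')
    fix m n
    assume "m \<in> N" "m < n"
    then show "fact m \<noteq> (fact n :: nat)"
      using fact_less_mono_nat[of m n] by (simp add: N_def)
  qed
  then have "bij_betw fact N (fact ` N :: nat set)"
    by (simp add: bij_betw_def)
  then have "bij_betw f (P \<union> N) (R \<union> fact ` N)"
    unfolding f_def by (intro bij_betw_disjoint_Un h) (auto simp: N_def R_def)
  moreover have "P \<union> N = pos_nats"
    by (auto simp: N_def P_def dest: prime_ge_1_nat)
  moreover have "R \<union> fact ` N = pos_nats"
    by (auto simp: R_def)
  ultimately have bij: "bij_betw f pos_nats pos_nats"
    by simp
  have "monotone_on pos_nats (dvd) (dvd) f"
  proof (rule monotone_onI)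
    fix x y :: nat
    assume xy: "x \<in> pos_nats" "y \<in> pos_nats" "x dvd y"
    then have le: "x \<le> y"
      by (auto intro: dvd_imp_le)
    consider "y \<in> P" | "x \<in> P" "y \<notin> P" | "x \<notin> P" "y \<notin> P"
      by blast
    then show "f x dvd f y"
    proof cases
      \<comment> \<open>A prime has only the divisors 1 and itself, and
        \<open>f 1 = 1\<close>.\<close>
      case 1
      then have "x = 1 \<or> x = y"
        using xy(3) by (auto simp: P_def prime_nat_iff)
      then show ?thesis
        by (auto simp: f_def P_def)
    next
      case 2
      \<comment> \<open>As 1 \<le> \<open>h x\<close> \<le> \<open>x\<close> \<le> \<open>y\<close>,
        the number \<open>h x\<close> is one of the factors of \<open>y\<close>!.\<close>
      then have "h x dvd fact y"
        using h_pos h_le le by (intro dvd_fact) force+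
      then show ?thesis
        using 2 by (simp add: f_def)
    next
      case 3
      then show ?thesis
        using le by (simp add: f_def fact_dvd)
    qed
  qed
  with rev bij have aut: "order_automorphism_on pos_nats (dvd) f"
    by (auto simp: reversible_on_def)
  have reflect: "x dvd y" if "x \<in> P" "y \<in> P" "h x dvd h y" for x y
  proof -
    have "x \<in> pos_nats" "y \<in> pos_nats"
      using that PR by (auto simp: R_def)
    then have "x dvd y \<longleftrightarrow> f x dvd f y"
      using aut unfolding order_automorphism_on_def by blast
    then show ?thesis
      using that by (simp add: f_def)
  qed
  have "k \<in> R" if "1 < k" "k < 24" for k
  proof -
    have "k \<noteq> fact n" if "n \<in> N" for n
      using fact_N[OF that] \<open>1 < k\<close> \<open>k < 24\<close> by linarith
    then show ?thesis
      using that by (auto simp: R_def)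
  qed
  then have "2 \<in> R" "4 \<in> R"
    by simp_all
  \<comment> \<open>Since 2 divides 4, reflection gives \<open>q dvd p\<close>; for primes this
    forces \<open>q = p\<close>, against 2 \<noteq> 4.\<close>
  then obtain q p where "q \<in> P" "h q = 2" "p \<in> P" "h p = 4"
    using bij_betw_imp_surj_on[OF h] by (metis imageE)
  moreover from this have "q dvd p"
    by (simp add: reflect)
  ultimately show False
    using primes_dvd_imp_eq[of q p] by (simp add: P_def)
qed

end
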